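(* Let $p$ be a prime number, let $n>0$ be an integer, and let $C$ be an abelian group. Assume that we have, for each $0<k\leq n$, an exact sequence of $\mathbb{Z}/p^k$-modules $$(\mathcal{S}_k)\qquad 0\longrightarrow A_k\longrightarrow B_k\longrightarrow C[p^k]\longrightarrow 0,$$ together with, for each $0<k<n$, a map of exact sequences $\mathcal{S}_k\to\mathcal{S}_{k+1}$, i.e. homomorphisms $A_k\to A_{k+1}$, $B_k\to B_{k+1}$ and $C[p^k]\to C[p^{k+1}]$ making the diagram formed with $\mathcal{S}_k$ and $\mathcal{S}_{k+1}$ commute, where the map $C[p^k]\to C[p^{k+1}]$ is the canonical inclusion. Then the exact sequence $\mathcal{S}_n$ splits.
   Context: For an abelian group $C$, $C[p^k]$ denotes the kernel of multiplication by $p^k$ on $C$. *)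

theory Defs
  imports "HOL-Algebra.Module" "HOL-Number_Theory.Residues"
begin

text \<open>
  Modules are those of \<^theory>\<open>HOL-Algebra.Module\<close>, over the ring \<open>\<int>/m\<close> given by
  \<^const>\<open>residue_ring\<close>. Module records extend ring records; the fields \<open>mult\<close> and \<open>one\<close> of a
  module (and of an abelian group) play no role.
\<close>

text \<open>
  \<open>C[m]\<close>, the kernel of multiplication by \<open>m\<close> on \<open>C\<close>. A residue class mod \<open>m\<close> is represented by
  an integer \<open>z\<close> in \<open>{0..m - 1}\<close> and acts as multiplication by \<open>z\<close>.
\<close>

definition torsion_module :: "('c, 'm) ring_scheme \<Rightarrow> nat \<Rightarrow> (int, 'c) module" where
  "torsion_module C m =
     \<lparr>carrier = a_kernel C C (\<lambda>c. [m] \<cdot>\<^bsub>C\<^esub> c), monoid.mult = monoid.mult C, one = one C,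
      zero = ring.zero C, add = ring.add C, smult = (\<lambda>z c. [z] \<cdot>\<^bsub>C\<^esub> c)\<rparr>"

definition module_homs ::
  "('r, 'k) ring_scheme \<Rightarrow> ('r, 'a, 'm) module_scheme \<Rightarrow> ('r, 'b, 'n) module_scheme \<Rightarrow> ('a \<Rightarrow> 'b) set"
  where
  "module_homs R M N =
     {h. abelian_group_hom M N h \<and>
         (\<forall>r\<in>carrier R. \<forall>x\<in>carrier M. h (r \<odot>\<^bsub>M\<^esub> x) = r \<odot>\<^bsub>N\<^esub> h x)}"

definition short_exact ::
  "('r, 'k) ring_scheme \<Rightarrow> ('r, 'a) module \<Rightarrow> ('r, 'b) module \<Rightarrow> ('r, 'c) module \<Rightarrow>
    ('a \<Rightarrow> 'b) \<Rightarrow> ('b \<Rightarrow> 'c) \<Rightarrow> bool" where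
  "short_exact R A B C f g \<longleftrightarrow>
     module R A \<and> module R B \<and> module R C \<and>
     f \<in> module_homs R A B \<and> g \<in> module_homs R B C \<and>
     a_kernel A B f = {\<zero>\<^bsub>A\<^esub>} \<and>
     a_kernel B C g = f ` carrier A \<and>
     g ` carrier B = carrier C"

text \<open>Splitting of a short exact sequence: \<open>g : B \<longrightarrow> C\<close> has an \<open>R\<close>-linear section.\<close>

definition splits ::
  "('r, 'k) ring_scheme \<Rightarrow> ('r, 'b) module \<Rightarrow> ('r, 'c) module \<Rightarrow> ('b \<Rightarrow> 'c) \<Rightarrow> bool" where
  "splits R B C g \<longleftrightarrow> (\<exists>s\<in>module_homs R C B. \<forall>c\<in>carrier C. g (s c) = c)"

text \<open>
  A map of sequences. The two sequences may consist of modules over different rings (here \<open>\<int>/p^k\<close>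
  and \<open>\<int>/p^(k+1)\<close>), so the components are homomorphisms of the underlying abelian groups.
\<close>

definition sequence_map ::
  "('r, 'a) module \<Rightarrow> ('r, 'b) module \<Rightarrow> ('r, 'c) module \<Rightarrow> ('a \<Rightarrow> 'b) \<Rightarrow> ('b \<Rightarrow> 'c) \<Rightarrow>
   ('r', 'a') module \<Rightarrow> ('r', 'b') module \<Rightarrow> ('r', 'c') module \<Rightarrow> ('a' \<Rightarrow> 'b') \<Rightarrow> ('b' \<Rightarrow> 'c') \<Rightarrow>
   ('a \<Rightarrow> 'a') \<Rightarrow> ('b \<Rightarrow> 'b') \<Rightarrow> ('c \<Rightarrow> 'c') \<Rightarrow> bool" where
  "sequence_map A B C f g A' B' C' f' g' \<alpha> \<beta> \<gamma> \<longleftrightarrow>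
     abelian_group_hom A A' \<alpha> \<and> abelian_group_hom B B' \<beta> \<and> abelian_group_hom C C' \<gamma> \<and>
     (\<forall>a\<in>carrier A. \<beta> (f a) = f' (\<alpha> a)) \<and>
     (\<forall>b\<in>carrier B. \<gamma> (g b) = g' (\<beta> b))"

lemma carrier_torsion_module:
  "carrier (torsion_module C m) = {c \<in> carrier C. [m] \<cdot>\<^bsub>C\<^esub> c = \<zero>\<^bsub>C\<^esub>}"
  by (simp add: torsion_module_def a_kernel_def')

lemma (in abelian_group) add_pow_mod:
  fixes m :: nat and z :: int
  assumes "x \<in> carrier G" "[m] \<cdot> x = \<zero>"
  shows "[(z mod int m)] \<cdot> x = [z] \<cdot> x"
proof -
  have m: "[(int m)] \<cdot> x = \<zero>"
    using assms(2) by (simp add: add_pow_int_ge)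
  have "[(int m * (z div int m))] \<cdot> x = \<zero>"
    using add.int_pow_pow[of x "z div int m" "int m"] assms(1) m
    by (simp add: mult.commute)
  moreover have "z = z mod int m + int m * (z div int m)" by simp
  ultimately show ?thesis
    using assms add.int_pow_mult[of x "z mod int m" "int m * (z div int m)"] by simp
qed

lemma module_torsion_module:
  assumes "abelian_group C" "m > 1"
  shows "module (residue_ring (int m)) (torsion_module C m)"
proof -
  interpret C: abelian_group C by fact
  interpret residues "int m" "residue_ring (int m)" using assms(2) by unfold_locales auto
  have closed: "[m] \<cdot>\<^bsub>C\<^esub> ([a] \<cdot>\<^bsub>C\<^esub> x) = \<zero>\<^bsub>C\<^esub>"
    if "0 \<le> a" "x \<in> carrier C" "[m] \<cdot>\<^bsub>C\<^esub> x = \<zero>\<^bsub>C\<^esub>" for a :: int and x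
    using C.add.nat_pow_pow[of x m "nat a"] C.add.nat_pow_pow[of x "nat a" m] that
    by (simp add: add_pow_int_ge mult.commute)
  show ?thesis
  proof (rule moduleI)
    show "cring (residue_ring (int m))" by (rule cring)
    show "abelian_group (torsion_module C m)"
    proof (rule abelian_groupI)
      fix x assume "x \<in> carrier (torsion_module C m)"
      then show "\<exists>y\<in>carrier (torsion_module C m). y \<oplus>\<^bsub>torsion_module C m\<^esub> x = \<zero>\<^bsub>torsion_module C m\<^esub>"
        by (intro bexI[of _ "\<ominus>\<^bsub>C\<^esub> x"])
          (auto simp: carrier_torsion_module torsion_module_def a_kernel_def' C.l_neg C.add.nat_pow_inv)
    qed (auto simp: torsion_module_def a_kernel_def' C.add.m_ac C.add.nat_pow_distrib)
  qed (auto simp: torsion_module_def a_kernel_def' residue_ring_def closed C.add_pow_mod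
        C.add.int_pow_mult C.add.int_pow_distrib C.add.int_pow_pow mult.commute)
qed

lemma torsion_module_inclusion:
  assumes "abelian_group C" "m > 1" "m' > 1" "m dvd m'"
  shows "abelian_group_hom (torsion_module C m) (torsion_module C m') (\<lambda>c. c)"
proof -
  interpret C: abelian_group C by fact
  interpret T: module "residue_ring (int m)" "torsion_module C m"
    using assms by (intro module_torsion_module)
  interpret T': module "residue_ring (int m')" "torsion_module C m'"
    using assms by (intro module_torsion_module)
  obtain d where d: "m' = m * d" using assms(4) by blast
  have "[m'] \<cdot>\<^bsub>C\<^esub> c = \<zero>\<^bsub>C\<^esub>" if "c \<in> carrier C" "[m] \<cdot>\<^bsub>C\<^esub> c = \<zero>\<^bsub>C\<^esub>" for c
    using C.add.nat_pow_pow[of c d m] that by (simp add: d mult.commute)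
  then show ?thesis
    by (intro abelian_group_homI T.abelian_group_axioms T'.abelian_group_axioms
        group_hom.intro group_hom_axioms.intro T.a_group T'.a_group homI)
      (auto simp: torsion_module_def a_kernel_def')
qed

end

theory Submission
  imports Defs "HOL-Algebra.Generated_Groups"
begin

text \<open>
  The maps between the sequences serve one purpose: they show that every \<open>y \<in> C[p^n]\<close> with
  \<open>p^k y = 0\<close> is the image under \<open>g\<^sub>n\<close> of some \<open>b \<in> B\<^sub>n\<close> with \<open>p^k b = 0\<close>. Indeed \<open>y\<close> already lies
  in \<open>C[p^k]\<close>, so it lifts to \<open>B\<^sub>k\<close>, a group killed by \<open>p^k\<close>; since the maps on the right are
  inclusions, pushing the lift forward along \<open>B\<^sub>k \<longrightarrow> \<dots> \<longrightarrow> B\<^sub>n\<close> yields \<open>b\<close>. In other words \<open>A\<^sub>n\<close> is a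
  pure subgroup of \<open>B\<^sub>n\<close>.

  What remains is a fact about abelian groups (\<open>bounded_pure_epimorphism_splits\<close>): an epimorphism
  \<open>g : G \<longrightarrow> H\<close> onto a group killed by \<open>p^n\<close> splits if elements of \<open>H\<close> lift to elements of \<open>G\<close>
  killed by the same power of \<open>p\<close>. One could decompose \<open>H\<close> into cyclic groups and lift the
  generators. The proof merges the two steps: by Zorn's lemma choose a maximal subgroup \<open>S\<close> of \<open>G\<close>
  that meets the kernel of \<open>g\<close> trivially and whose image \<open>N\<close> is pure in \<open>H\<close>. If \<open>N \<noteq> H\<close>, pick a
  class of maximal order \<open>p^k\<close> in \<open>H/N\<close>. Purity of \<open>N\<close> provides a representative \<open>x\<close> that is itself
  killed by \<open>p^k\<close> (\<open>exists_element_of_maximal_order\<close>), so that \<open>N\<close> and the group generated by \<open>x\<close>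
  meet trivially. Maximality of the order makes \<open>N + \<int>x\<close> pure again (\<open>p_pure_adjoin\<close>), and
  adjoining to \<open>S\<close> a lift of \<open>x\<close> that is killed by \<open>p^k\<close> contradicts the choice of \<open>S\<close>. Hence \<open>S\<close>
  maps isomorphically onto \<open>H\<close>, and the inverse is the section.

  A homomorphism of additive groups between \<open>\<int>/m\<close>-modules is automatically linear, because
  residue classes act by repeated addition.
\<close>

section \<open>Pure subgroups and adjoining an element\<close>

text \<open>
  In additive notation this reads \<open>N \<inter> p^j G = p^j N\<close>, which for groups killed by a power of the
  prime \<open>p\<close> is purity. Exponents are integers throughout, so that they may be combined with the
  coefficients produced by Bezout's identity.
\<close>

definition p_pure :: "int \<Rightarrow> ('a, 'm) monoid_scheme \<Rightarrow> 'a set \<Rightarrow> bool" where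
  "p_pure p G N \<longleftrightarrow>
     (\<forall>x\<in>carrier G. \<forall>j::nat. x [^]\<^bsub>G\<^esub> (p ^ j) \<in> N \<longrightarrow> (\<exists>z\<in>N. x [^]\<^bsub>G\<^esub> (p ^ j) = z [^]\<^bsub>G\<^esub> (p ^ j)))"

definition adjoin :: "('a, 'm) monoid_scheme \<Rightarrow> 'a \<Rightarrow> 'a set \<Rightarrow> 'a set" where
  "adjoin G x N = {a \<otimes>\<^bsub>G\<^esub> x [^]\<^bsub>G\<^esub> m |a m::int. a \<in> N}"

lemma (in comm_group) subgroup_adjoin:
  assumes "subgroup N G" and "x \<in> carrier G"
  shows "subgroup (adjoin G x N) G"
proof -
  have "adjoin G x N = N <#> generate G {x}"
    unfolding adjoin_def set_mult_def generate_pow[OF assms(2)] by auto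
  then show ?thesis
    using mult_subgroups[OF assms(1)] generate_is_subgroup[of "{x}"] assms(2) by simp
qed

lemma (in group) subset_adjoin:
  assumes "subgroup N G" and "x \<in> carrier G"
  shows "N \<subseteq> adjoin G x N"
proof
  fix a assume "a \<in> N"
  then have "a = a \<otimes> x [^] (0::int)"
    using subgroup.mem_carrier[OF assms(1)] by simp
  then show "a \<in> adjoin G x N" unfolding adjoin_def using \<open>a \<in> N\<close> by blast
qed

lemma (in group) mem_adjoin_self:
  assumes "subgroup N G" and "x \<in> carrier G"
  shows "x \<in> adjoin G x N"
proof -
  have "x = \<one> \<otimes> x [^] (1::int)" using assms(2) by simp
  then show ?thesis unfolding adjoin_def using subgroup.one_closed[OF assms(1)] by blast
qed

text \<open>
  The exponents \<open>e\<close> with \<open>x^e \<in> N\<close> form an ideal of \<open>\<int>\<close>. It contains \<open>p^k\<close>, hence is generated by a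
  power of \<open>p\<close>, and no smaller power than \<open>p^k\<close> belongs to it.
\<close>

lemma (in group) prime_power_order_dvd:
  fixes p m :: int
  assumes "subgroup N G" and x: "x \<in> carrier G" and p: "prime p"
    and xk: "x [^] (p ^ k) \<in> N" and xi: "\<And>i. i < k \<Longrightarrow> x [^] (p ^ i) \<notin> N"
    and xm: "x [^] m \<in> N"
  shows "p ^ k dvd m"
proof -
  interpret N: subgroup N G by fact
  obtain u v where uv: "u * m + v * p ^ k = gcd m (p ^ k)"
    using bezout_int by blast
  have "x [^] gcd m (p ^ k) = (x [^] m) [^] u \<otimes> (x [^] (p ^ k)) [^] v"
    using x by (simp add: int_pow_pow int_pow_mult mult.commute flip: uv)
  also have "\<dots> \<in> N"
    using xk xm subgroup_int_pow_closed[OF assms(1)] by simp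
  finally have "x [^] gcd m (p ^ k) \<in> N" .
  moreover obtain i where "i \<le> k" and i: "gcd m (p ^ k) = p ^ i"
    using divides_primepow[OF p, of "gcd m (p ^ k)" k] by auto
  ultimately have "i = k" using xi[of i] by force
  then show ?thesis using i gcd_dvd1[of m "p ^ k"] by simp
qed

text \<open>
  The last assumption says that the class of \<open>x\<close> has the largest possible order \<open>p^k\<close> in \<open>G/N\<close>.
  It is what makes the group generated by that class pure in \<open>G/N\<close>, and purity then passes to its
  preimage because \<open>N\<close> is pure in \<open>G\<close>.
\<close>

lemma (in comm_group) p_pure_adjoin:
  fixes p :: int
  assumes N: "subgroup N G" and pure: "p_pure p G N" and x: "x \<in> carrier G" and p: "prime p"
    and xk: "x [^] (p ^ k) = \<one>" and xi: "\<And>i. i < k \<Longrightarrow> x [^] (p ^ i) \<notin> N"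
    and exponent: "\<And>y. y \<in> carrier G \<Longrightarrow> y [^] (p ^ k) \<in> N"
  shows "p_pure p G (adjoin G x N)"
  unfolding p_pure_def
proof (intro ballI allI impI)
  interpret N: subgroup N G by fact
  fix y and j :: nat
  assume y: "y \<in> carrier G" and "y [^] (p ^ j) \<in> adjoin G x N"
  then obtain a and m :: int where a: "a \<in> N" and yj: "y [^] (p ^ j) = a \<otimes> x [^] m"
    unfolding adjoin_def by blast
  have aG: "a \<in> carrier G" using a by simp
  show "\<exists>z\<in>adjoin G x N. y [^] (p ^ j) = z [^] (p ^ j)"
  proof (cases "k \<le> j")
    case True
    then have "y [^] (p ^ j) = (y [^] (p ^ k)) [^] (p ^ (j - k))"
      using y by (simp add: int_pow_pow flip: power_add)
    then have "y [^] (p ^ j) \<in> N"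
      using exponent[OF y] subgroup_int_pow_closed[OF N] by simp
    then show ?thesis
      using pure y subset_adjoin[OF N x] unfolding p_pure_def by blast
  next
    case False
    \<comment> \<open>Raising to \<open>p^(k-j)\<close> puts the left-hand side of \<open>yj\<close> into \<open>N\<close>; comparing orders
      modulo \<open>N\<close> then forces \<open>p^j\<close> to divide \<open>m\<close>.\<close>
    have "a [^] (p ^ (k - j)) \<otimes> x [^] (m * p ^ (k - j)) = (a \<otimes> x [^] m) [^] (p ^ (k - j))"
      using aG x by (simp add: int_pow_distrib int_pow_pow)
    also have "\<dots> = y [^] (p ^ k)"
      using False y by (simp add: int_pow_pow flip: yj power_add)
    finally have "x [^] (m * p ^ (k - j)) = inv (a [^] (p ^ (k - j))) \<otimes> y [^] (p ^ k)"
      using aG x y by (metis inv_solve_left int_pow_closed)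
    then have "x [^] (m * p ^ (k - j)) \<in> N"
      using exponent[OF y] subgroup_int_pow_closed[OF N a] by simp
    then have "p ^ k dvd m * p ^ (k - j)"
      using prime_power_order_dvd[OF N x p _ xi] xk by simp
    moreover have "p ^ k = p ^ j * p ^ (k - j)"
      using False by (simp flip: power_add)
    moreover have "p ^ (k - j) \<noteq> 0" using p by auto
    ultimately obtain m' where m: "m = p ^ j * m'" by (auto simp: dvd_def)
    \<comment> \<open>Dividing \<open>y\<close> by \<open>x^m'\<close> removes the \<open>x\<close>-part of its \<open>p^j\<close>-th power.\<close>
    define w where "w = y \<otimes> x [^] (- m')"
    have wG: "w \<in> carrier G" using x y by (simp add: w_def)
    have "w [^] (p ^ j) = (a \<otimes> x [^] m) \<otimes> x [^] (- m)"
      using x y by (simp add: w_def int_pow_distrib int_pow_pow yj m mult.commute)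
    also have "\<dots> = a"
      using aG x by (simp add: m_assoc int_pow_neg)
    finally have "w [^] (p ^ j) = a" .
    then obtain z where z: "z \<in> N" and "a = z [^] (p ^ j)"
      using pure wG a unfolding p_pure_def by metis
    then have "y [^] (p ^ j) = (z \<otimes> x [^] m') [^] (p ^ j)"
      using x by (simp add: yj m int_pow_distrib int_pow_pow mult.commute)
    then show ?thesis
      using z unfolding adjoin_def by blast
  qed
qed

text \<open>
  Any class of maximal order \<open>p^k\<close> in \<open>G/N\<close> has a representative killed by \<open>p^k\<close>: if \<open>x0\<close> is some
  representative, purity writes \<open>x0^(p^k) \<in> N\<close> as \<open>z^(p^k)\<close> with \<open>z \<in> N\<close>, and \<open>x0 / z\<close> is as wanted.
\<close>

lemma (in comm_group) exists_element_of_maximal_order: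
  fixes p :: int
  assumes N: "subgroup N G" and pure: "p_pure p G N" and proper: "N \<noteq> carrier G"
    and bounded: "\<And>y. y \<in> carrier G \<Longrightarrow> y [^] (p ^ n) = \<one>"
  obtains x and k :: nat where "k \<le> n" "x \<in> carrier G" "x \<notin> N" "x [^] (p ^ k) = \<one>"
    "\<And>i. i < k \<Longrightarrow> x [^] (p ^ i) \<notin> N" "\<And>y. y \<in> carrier G \<Longrightarrow> y [^] (p ^ k) \<in> N"
proof -
  interpret N: subgroup N G by fact
  define P where "P k \<longleftrightarrow> (\<forall>y\<in>carrier G. y [^] (p ^ k) \<in> N)" for k :: nat
  define k where "k = (LEAST k. P k)"
  have "P n" using bounded by (simp add: P_def)
  then have Pk: "P k" and kn: "k \<le> n" unfolding k_def by (auto intro: LeastI Least_le)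
  have "\<not> P 0" using proper N.subset by (auto simp: P_def)
  then have "k \<noteq> 0" using Pk by metis
  then obtain k' where k': "k = Suc k'" by (cases k) auto
  then have "\<not> P k'" using not_less_Least[of k' P] by (simp add: k_def)
  then obtain x0 where x0: "x0 \<in> carrier G" and x0k': "x0 [^] (p ^ k') \<notin> N"
    unfolding P_def by blast
  have x0i: "x0 [^] (p ^ i) \<notin> N" if "i < k" for i
  proof
    assume "x0 [^] (p ^ i) \<in> N"
    then have "(x0 [^] (p ^ i)) [^] (p ^ (k' - i)) \<in> N"
      using subgroup_int_pow_closed[OF N] by simp
    moreover have "(x0 [^] (p ^ i)) [^] (p ^ (k' - i)) = x0 [^] (p ^ k')"
      using x0 that k' by (simp add: int_pow_pow flip: power_add)
    ultimately show False using x0k' by simp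
  qed
  have "x0 [^] (p ^ k) \<in> N" using Pk x0 by (simp add: P_def)
  then obtain z where z: "z \<in> N" and x0k: "x0 [^] (p ^ k) = z [^] (p ^ k)"
    using pure x0 unfolding p_pure_def by blast
  define x where "x = x0 \<otimes> inv z"
  have xG: "x \<in> carrier G" using x0 z by (simp add: x_def)
  have pow: "x [^] i = x0 [^] i \<otimes> inv (z [^] i)" for i :: int
    using x0 z by (simp add: x_def int_pow_distrib int_pow_inv)
  have xi: "x [^] (p ^ i) \<notin> N" if "i < k" for i
  proof
    assume "x [^] (p ^ i) \<in> N"
    then have "x [^] (p ^ i) \<otimes> z [^] (p ^ i) \<in> N"
      using subgroup_int_pow_closed[OF N z] by simp
    moreover have "x [^] (p ^ i) \<otimes> z [^] (p ^ i) = x0 [^] (p ^ i)"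
      using x0 z by (simp add: pow m_assoc)
    ultimately show False using x0i[OF that] by simp
  qed
  show thesis
  proof (rule that[OF kn xG])
    show "x \<notin> N" using xi[of 0] \<open>k \<noteq> 0\<close> xG by simp
    show "x [^] (p ^ k) = \<one>" using x0 z by (simp add: pow x0k)
  qed (use xi Pk in \<open>auto simp: P_def\<close>)
qed

section \<open>Splitting pure epimorphisms onto bounded groups\<close>

lemma (in group) subgroup_Union_chain:
  assumes ne: "\<C> \<noteq> {}" and sub: "\<And>S. S \<in> \<C> \<Longrightarrow> subgroup S G"
    and chain: "\<And>S T. S \<in> \<C> \<Longrightarrow> T \<in> \<C> \<Longrightarrow> S \<subseteq> T \<or> T \<subseteq> S"
  shows "subgroup (\<Union>\<C>) G"
proof (rule subgroupI)
  show "\<Union>\<C> \<subseteq> carrier G" using sub subgroup.subset by blast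
  show "\<Union>\<C> \<noteq> {}" using ne sub subgroup.one_closed by blast
  show "inv a \<in> \<Union>\<C>" if "a \<in> \<Union>\<C>" for a
    using that sub subgroup.m_inv_closed by (metis Union_iff)
  show "a \<otimes> b \<in> \<Union>\<C>" if ab: "a \<in> \<Union>\<C>" "b \<in> \<Union>\<C>" for a b
  proof -
    obtain S T where "S \<in> \<C>" "a \<in> S" "T \<in> \<C>" "b \<in> T" using ab by blast
    with chain[of S T] obtain U where "U \<in> \<C>" "a \<in> U" "b \<in> U" by blast
    then show ?thesis using subgroup.m_closed[OF sub[of U]] by blast
  qed
qed

lemma (in group_hom) image_adjoin:
  assumes "S \<subseteq> carrier G" and "b \<in> carrier G"
  shows "h ` adjoin G b S = adjoin H (h b) (h ` S)"
proof -
  have "h (a \<otimes> b [^] m) = h a \<otimes>\<^bsub>H\<^esub> h b [^]\<^bsub>H\<^esub> m" if "a \<in> S" for a and m :: int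
    using that assms by (auto simp: hom_int_pow subsetD)
  then show ?thesis unfolding adjoin_def by (auto simp: image_iff) metis+
qed

lemma section_of_complement:
  assumes "group_hom G H g" and S: "subgroup S G" and surj: "g ` S = carrier H"
    and ker: "\<And>s. s \<in> S \<Longrightarrow> g s = \<one>\<^bsub>H\<^esub> \<Longrightarrow> s = \<one>\<^bsub>G\<^esub>"
  shows "\<exists>\<sigma>\<in>hom H G. \<forall>y\<in>carrier H. g (\<sigma> y) = y"
proof -
  interpret group_hom G H g by fact
  interpret S: subgroup S G by fact
  have inj: "inj_on g S"
  proof (rule inj_onI)
    fix s t assume st: "s \<in> S" "t \<in> S" "g s = g t"
    then have "s \<otimes>\<^bsub>G\<^esub> inv\<^bsub>G\<^esub> t = \<one>\<^bsub>G\<^esub>" by (intro ker) simp_all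
    then show "s = t" using st G.inv_equality[of s "inv\<^bsub>G\<^esub> t"] by simp
  qed
  let ?\<sigma> = "inv_into S g"
  have mem: "?\<sigma> y \<in> S" and g\<sigma>: "g (?\<sigma> y) = y" if "y \<in> carrier H" for y
    using that surj inv_into_into[of y g S] f_inv_into_f[of y g S] by auto
  have "?\<sigma> \<in> hom H G"
  proof (rule homI)
    fix y z assume yz: "y \<in> carrier H" "z \<in> carrier H"
    show "?\<sigma> (y \<otimes>\<^bsub>H\<^esub> z) = ?\<sigma> y \<otimes>\<^bsub>G\<^esub> ?\<sigma> z"
      by (rule inv_into_f_eq[OF inj]) (use mem g\<sigma> yz in auto)
  qed (use mem in auto)
  then show ?thesis using g\<sigma> by blast
qed

text \<open>
  The lifting hypothesis contains surjectivity of \<open>g\<close> (take \<open>k = n\<close>). The Zorn argument runs over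
  subgroups of \<open>G\<close> on which \<open>g\<close> is injective, that is, over the images of partial sections of
  \<open>g\<close>; this avoids having to extend partially defined homomorphisms.
\<close>

theorem bounded_pure_epimorphism_splits:
  fixes p :: int
  assumes "comm_group G" and "comm_group H" and hom: "g \<in> hom G H" and p: "prime p"
    and bounded: "\<And>y. y \<in> carrier H \<Longrightarrow> y [^]\<^bsub>H\<^esub> (p ^ n) = \<one>\<^bsub>H\<^esub>"
    and lift: "\<And>k y. k \<le> n \<Longrightarrow> y \<in> carrier H \<Longrightarrow> y [^]\<^bsub>H\<^esub> (p ^ k) = \<one>\<^bsub>H\<^esub> \<Longrightarrow>
                 \<exists>b\<in>carrier G. b [^]\<^bsub>G\<^esub> (p ^ k) = \<one>\<^bsub>G\<^esub> \<and> g b = y"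
  shows "\<exists>\<sigma>\<in>hom H G. \<forall>y\<in>carrier H. g (\<sigma> y) = y"
proof -
  interpret G: comm_group G by fact
  interpret H: comm_group H by fact
  interpret g: group_hom G H g using hom by unfold_locales
  define \<A> where "\<A> = {S. subgroup S G \<and> (\<forall>s\<in>S. g s = \<one>\<^bsub>H\<^esub> \<longrightarrow> s = \<one>\<^bsub>G\<^esub>) \<and> p_pure p H (g ` S)}"
  have "\<exists>M\<in>\<A>. \<forall>X\<in>\<A>. M \<subseteq> X \<longrightarrow> X = M"
  proof (rule subset_Zorn_nonempty)
    have "{\<one>\<^bsub>G\<^esub>} \<in> \<A>"
      using G.triv_subgroup by (auto simp: \<A>_def p_pure_def)
    then show "\<A> \<noteq> {}" by blast
    fix \<C> assume ne: "\<C> \<noteq> {}" and chain: "subset.chain \<A> \<C>"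
    have CA: "\<C> \<subseteq> \<A>" and lin: "\<And>S T. S \<in> \<C> \<Longrightarrow> T \<in> \<C> \<Longrightarrow> S \<subseteq> T \<or> T \<subseteq> S"
      using chain unfolding subset_chain_def by auto
    have "subgroup (\<Union>\<C>) G"
      using CA lin by (intro G.subgroup_Union_chain[OF ne]) (auto simp: \<A>_def)
    moreover have "p_pure p H (g ` \<Union>\<C>)"
      unfolding p_pure_def
    proof (intro ballI allI impI)
      fix y and j :: nat
      assume y: "y \<in> carrier H" and "y [^]\<^bsub>H\<^esub> (p ^ j) \<in> g ` \<Union>\<C>"
      then obtain S where S: "S \<in> \<C>" and "y [^]\<^bsub>H\<^esub> (p ^ j) \<in> g ` S" by blast
      moreover have "p_pure p H (g ` S)" using S CA by (auto simp: \<A>_def)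
      ultimately obtain z where "z \<in> g ` S" "y [^]\<^bsub>H\<^esub> (p ^ j) = z [^]\<^bsub>H\<^esub> (p ^ j)"
        using y unfolding p_pure_def by blast
      then show "\<exists>z\<in>g ` \<Union>\<C>. y [^]\<^bsub>H\<^esub> (p ^ j) = z [^]\<^bsub>H\<^esub> (p ^ j)" using S by blast
    qed
    ultimately show "\<Union>\<C> \<in> \<A>" using CA by (auto simp: \<A>_def)
  qed
  then obtain S where "S \<in> \<A>" and max: "\<And>X. X \<in> \<A> \<Longrightarrow> S \<subseteq> X \<Longrightarrow> X = S" by blast
  then have S: "subgroup S G" and ker: "\<And>s. s \<in> S \<Longrightarrow> g s = \<one>\<^bsub>H\<^esub> \<Longrightarrow> s = \<one>\<^bsub>G\<^esub>"
    and pure: "p_pure p H (g ` S)" by (auto simp: \<A>_def)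
  interpret S: subgroup S G by fact
  have N: "subgroup (g ` S) H" using S by (rule g.subgroup_img_is_subgroup)
  have "g ` S = carrier H"
  proof (rule ccontr)
    assume "g ` S \<noteq> carrier H"
    then obtain x k where kn: "k \<le> n" and x: "x \<in> carrier H" and xS: "x \<notin> g ` S"
      and xk: "x [^]\<^bsub>H\<^esub> (p ^ k) = \<one>\<^bsub>H\<^esub>" and xi: "\<And>i. i < k \<Longrightarrow> x [^]\<^bsub>H\<^esub> (p ^ i) \<notin> g ` S"
      and exponent: "\<And>y. y \<in> carrier H \<Longrightarrow> y [^]\<^bsub>H\<^esub> (p ^ k) \<in> g ` S"
      using H.exists_element_of_maximal_order[OF N pure _ bounded] by metis
    obtain b where b: "b \<in> carrier G" and bk: "b [^]\<^bsub>G\<^esub> (p ^ k) = \<one>\<^bsub>G\<^esub>" and gb: "g b = x"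
      using lift[OF kn x xk] by blast
    have img: "g ` adjoin G b S = adjoin H x (g ` S)"
      using g.image_adjoin[OF S.subset b] gb by simp
    have "adjoin G b S \<in> \<A>"
      unfolding \<A>_def
    proof (intro CollectI conjI ballI impI)
      show "subgroup (adjoin G b S) G" by (rule G.subgroup_adjoin[OF S b])
      show "p_pure p H (g ` adjoin G b S)"
        unfolding img by (rule H.p_pure_adjoin[OF N pure x p xk xi exponent])
      fix t assume "t \<in> adjoin G b S" and gt: "g t = \<one>\<^bsub>H\<^esub>"
      then obtain s and m :: int where s: "s \<in> S" and t: "t = s \<otimes>\<^bsub>G\<^esub> b [^]\<^bsub>G\<^esub> m"
        unfolding adjoin_def by blast
      have "g s \<otimes>\<^bsub>H\<^esub> x [^]\<^bsub>H\<^esub> m = \<one>\<^bsub>H\<^esub>"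
        using gt s b by (simp add: t g.hom_int_pow gb)
      then have "x [^]\<^bsub>H\<^esub> m = g (inv\<^bsub>G\<^esub> s)"
        using s x H.inv_equality[of "x [^]\<^bsub>H\<^esub> m" "g s"] H.m_comm by simp
      \<comment> \<open>So \<open>m\<close> is a multiple of \<open>p^k\<close>, which kills the lift \<open>b\<close> and not only \<open>x\<close>.\<close>
      then have "x [^]\<^bsub>H\<^esub> m \<in> g ` S" using s by blast
      then have "p ^ k dvd m"
        using H.prime_power_order_dvd[OF N x p _ xi] exponent[OF x] by blast
      then have "b [^]\<^bsub>G\<^esub> m = \<one>\<^bsub>G\<^esub>"
        using b bk by (auto simp: dvd_def simp flip: G.int_pow_pow)
      then show "t = \<one>\<^bsub>G\<^esub>" using ker[OF s] gt s by (simp add: t)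
    qed
    then have "adjoin G b S = S"
      using max G.subset_adjoin[OF S b] by blast
    then show False using G.mem_adjoin_self[OF S b] gb xS by blast
  qed
  then show ?thesis
    using section_of_complement[OF g.group_hom_axioms S _ ker] by blast
qed

section \<open>Modules over residue rings\<close>

lemma residue_ring_add_pow:
  fixes m r :: nat
  assumes "module (residue_ring (int m)) M" and m: "m > 1" and x: "x \<in> carrier M"
  shows "[r] \<cdot>\<^bsub>M\<^esub> x = (int r mod int m) \<odot>\<^bsub>M\<^esub> x"
proof (induction r)
  interpret module "residue_ring (int m)" M by fact
  case 0
  show ?case using smult_l_null[OF x] by (simp add: residue_ring_def)
next
  interpret module "residue_ring (int m)" M by fact
  case (Suc r)
  have "(int r mod int m) \<oplus>\<^bsub>residue_ring (int m)\<^esub> 1 = int (Suc r) mod int m"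
    by (simp add: residue_ring_def mod_simps add.commute)
  moreover have "1 \<odot>\<^bsub>M\<^esub> x = x"
    using smult_one[OF x] by (simp add: residue_ring_def)
  ultimately have "(int (Suc r) mod int m) \<odot>\<^bsub>M\<^esub> x = (int r mod int m) \<odot>\<^bsub>M\<^esub> x \<oplus>\<^bsub>M\<^esub> x"
    using smult_l_distr[of "int r mod int m" 1 x] m x
    by (simp add: residue_ring_def)
  then show ?case using Suc by simp
qed

lemma residue_ring_annihilates:
  assumes "module (residue_ring (int m)) M" and "m > 1" and "x \<in> carrier M"
  shows "[m] \<cdot>\<^bsub>M\<^esub> x = \<zero>\<^bsub>M\<^esub>"
  using residue_ring_add_pow[OF assms, of m] residue_ring_add_pow[OF assms, of 0]
  by (simp add: add_pow_def)

lemma residue_ring_additive_imp_linear: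
  assumes M: "module (residue_ring (int m)) M" and N: "module (residue_ring (int m)) N"
    and m: "m > 1" and h: "h \<in> hom (add_monoid M) (add_monoid N)"
  shows "h \<in> module_homs (residue_ring (int m)) M N"
proof -
  interpret M: module "residue_ring (int m)" M by fact
  interpret N: module "residue_ring (int m)" N by fact
  interpret h: group_hom "add_monoid M" "add_monoid N" h
    using h by (intro group_hom.intro group_hom_axioms.intro M.a_group N.a_group)
  interpret h: abelian_group_hom M N h
    by (intro abelian_group_homI M.abelian_group_axioms N.abelian_group_axioms h.group_hom_axioms)
  have "h (r \<odot>\<^bsub>M\<^esub> x) = r \<odot>\<^bsub>N\<^esub> h x"
    if r: "r \<in> carrier (residue_ring (int m))" and x: "x \<in> carrier M" for r x
  proof -
    have "r = int (nat r) mod int m" using r by (simp add: residue_ring_def)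
    then have "r \<odot>\<^bsub>M\<^esub> x = [nat r] \<cdot>\<^bsub>M\<^esub> x" "r \<odot>\<^bsub>N\<^esub> h x = [nat r] \<cdot>\<^bsub>N\<^esub> h x"
      using residue_ring_add_pow[OF M m x] residue_ring_add_pow[OF N m h.hom_closed] x by auto
    moreover have "h ([nat r] \<cdot>\<^bsub>M\<^esub> x) = [nat r] \<cdot>\<^bsub>N\<^esub> h x"
      using h.hom_nat_pow x by (simp add: add_pow_def)
    ultimately show ?thesis by simp
  qed
  then show ?thesis
    using h.abelian_group_hom_axioms by (simp add: module_homs_def)
qed

lemma torsion_module_add_pow: "[r] \<cdot>\<^bsub>torsion_module C m\<^esub> c = [r] \<cdot>\<^bsub>C\<^esub> c" for r :: nat
  by (simp add: add_pow_def nat_pow_def torsion_module_def)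

section \<open>Compatible sequences over the torsion subgroups\<close>

theorem lemma2p1:
  fixes p n :: nat
    and C :: "('c, 'm) ring_scheme"
    and A :: "nat \<Rightarrow> (int, 'a) module" and B :: "nat \<Rightarrow> (int, 'b) module"
    and f :: "nat \<Rightarrow> 'a \<Rightarrow> 'b" and g :: "nat \<Rightarrow> 'b \<Rightarrow> 'c"
    and \<alpha> :: "nat \<Rightarrow> 'a \<Rightarrow> 'a" and \<beta> :: "nat \<Rightarrow> 'b \<Rightarrow> 'b"
  assumes "prime p" and "n > 0" and "abelian_group C"
    and "\<And>k. 0 < k \<Longrightarrow> k \<le> n \<Longrightarrow>
           short_exact (residue_ring (int (p ^ k)))
             (A k) (B k) (torsion_module C (p ^ k)) (f k) (g k)"
    and "\<And>k. 0 < k \<Longrightarrow> k < n \<Longrightarrow>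
           sequence_map
             (A k) (B k) (torsion_module C (p ^ k)) (f k) (g k)
             (A (k + 1)) (B (k + 1)) (torsion_module C (p ^ (k + 1))) (f (k + 1)) (g (k + 1))
             (\<alpha> k) (\<beta> k) (\<lambda>c. c)"
  shows "splits (residue_ring (int (p ^ n))) (B n) (torsion_module C (p ^ n)) (g n)"
proof -
  let ?T = "\<lambda>k. torsion_module C (p ^ k)"
  have gt1: "p ^ k > 1" if "k > 0" for k
    using prime_gt_1_nat[OF assms(1)] that one_less_power[of p k] by simp
  have modB: "module (residue_ring (int (p ^ k))) (B k)"
    and modT: "module (residue_ring (int (p ^ k))) (?T k)"
    and homg: "abelian_group_hom (B k) (?T k) (g k)"
    and surj: "g k ` carrier (B k) = carrier (?T k)" if "0 < k" "k \<le> n" for k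
    using assms(4)[OF that] by (auto simp: short_exact_def module_homs_def)
  have hom\<beta>: "abelian_group_hom (B k) (B (Suc k)) (\<beta> k)"
    and g\<beta>: "\<And>b. b \<in> carrier (B k) \<Longrightarrow> g (Suc k) (\<beta> k b) = g k b" if "0 < k" "k < n" for k
    using assms(5)[OF that] by (auto simp: sequence_map_def)
  interpret B: module "residue_ring (int (p ^ n))" "B n" using modB assms(2) by simp
  interpret T: module "residue_ring (int (p ^ n))" "?T n" using modT assms(2) by simp
  interpret g: abelian_group_hom "B n" "?T n" "g n" using homg assms(2) by simp
  interpret g': group_hom "add_monoid (B n)" "add_monoid (?T n)" "g n" by (rule g.a_group_hom)

  \<comment> \<open>Elements of \<open>B k\<close> are killed by \<open>p^k\<close>, and so are their images further along the tower.\<close>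
  have transport: "\<exists>b'\<in>carrier (B j). [(p ^ k)] \<cdot>\<^bsub>B j\<^esub> b' = \<zero>\<^bsub>B j\<^esub> \<and> g j b' = g k b"
    if "0 < k" "k \<le> j" "j \<le> n" "b \<in> carrier (B k)" for k j b
    using that(2,3)
  proof (induction j rule: dec_induct)
    case base
    then show ?case
      using residue_ring_annihilates[OF modB gt1] that by auto
  next
    case (step j)
    then obtain b' where b': "b' \<in> carrier (B j)" "[(p ^ k)] \<cdot>\<^bsub>B j\<^esub> b' = \<zero>\<^bsub>B j\<^esub>" "g j b' = g k b"
      by auto
    have j: "0 < j" "j < n" using step that(1) by auto
    interpret \<beta>: group_hom "add_monoid (B j)" "add_monoid (B (Suc j))" "\<beta> j"
      by (rule abelian_group_hom.a_group_hom[OF hom\<beta>[OF j]])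
    have "[(p ^ k)] \<cdot>\<^bsub>B (Suc j)\<^esub> \<beta> j b' = \<beta> j ([(p ^ k)] \<cdot>\<^bsub>B j\<^esub> b')"
      using \<beta>.hom_nat_pow b'(1) by (simp add: add_pow_def)
    also have "\<dots> = \<zero>\<^bsub>B (Suc j)\<^esub>"
      using \<beta>.hom_one b'(2) by simp
    finally show ?case
      using b' g\<beta>[OF j] \<beta>.hom_closed by (intro bexI[of _ "\<beta> j b'"]) auto
  qed

  have lift: "\<exists>b\<in>carrier (B n). [(p ^ k)] \<cdot>\<^bsub>B n\<^esub> b = \<zero>\<^bsub>B n\<^esub> \<and> g n b = y"
    if k: "k \<le> n" and y: "y \<in> carrier (?T n)" and yk: "[(p ^ k)] \<cdot>\<^bsub>?T n\<^esub> y = \<zero>\<^bsub>?T n\<^esub>" for k y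
    \<comment> \<open>There is no sequence for \<open>k = 0\<close>, but then \<open>y\<close> is zero.\<close>
  proof (cases "k = 0")
    case True
    then have "y = \<zero>\<^bsub>?T n\<^esub>" using yk y by simp
    then show ?thesis using g'.hom_one by (intro bexI[of _ "\<zero>\<^bsub>B n\<^esub>"]) auto
  next
    case False
    have "y \<in> carrier (?T k)"
      using y yk by (simp add: carrier_torsion_module torsion_module_add_pow)
        (simp add: torsion_module_def)
    then obtain b where "b \<in> carrier (B k)" "g k b = y"
      using surj[of k] False k by (metis gr0I imageE)
    then show ?thesis using transport[of k n b] False k by auto
  qed

  have pow: "x [^]\<^bsub>add_monoid M\<^esub> (int p ^ k) = [(p ^ k)] \<cdot>\<^bsub>M\<^esub> x" for M :: "('x, 'y) ring_scheme" and x k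
    using int_pow_int[of "add_monoid M" x "p ^ k"] by (simp add: add_pow_def)
  have "\<exists>\<sigma>\<in>hom (add_monoid (?T n)) (add_monoid (B n)). \<forall>y\<in>carrier (?T n). g n (\<sigma> y) = y"
    using bounded_pure_epimorphism_splits[of "add_monoid (B n)" "add_monoid (?T n)" "g n" "int p" n]
      B.a_comm_group T.a_comm_group g'.homh assms(1) lift
      residue_ring_annihilates[OF T.module_axioms gt1[OF assms(2)]]
    by (simp add: pow)
  then show ?thesis
    unfolding splits_def
    using residue_ring_additive_imp_linear[OF T.module_axioms B.module_axioms gt1[OF assms(2)]]
    by blast
qed

end
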